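(* There is an absolute constant $C>0$ such that for every instance of the problem below and every starvation threshold $\theta>0$, \[ \sum_{i=1}^{n}\mathrm{starv}_i(\theta)^2 \;\le\; C\,\frac{n}{\sqrt{\theta}}\,F(\mathcal{OPT}). \]
   Context: Problem: a single machine and $n$ jobs $J_1,\dots,J_n$; job $J_i$ has an integer release time $r_i\ge 0$ and an integer processing time $p_i\ge 1$. Time is divided into unit slots $[t]=[t,t+1)$, $t\in\mathbb{N}=\{0,1,2,\dots\}$. A (preemptive) schedule $\mathcal{S}$ assigns to each slot at most one job, so that $J_i$ is assigned exactly $p_i$ slots, all with $t\ge r_i$. View $J_i$ as a chain of unit tasks $J_{i,1},\dots,J_{i,p_i}$: the $k$-th slot assigned to $J_i$ executes $J_{i,k}$; a task executed in slot $[t]$ completes at $t+1$. $c_i(\mathcal{S})$ is the completion time of $J_i$, $f_i(\mathcal{S})=c_i(\mathcal{S})-r_i$, $F(\mathcal{S})=\sum_i f_i(\mathcal{S})^2$, and $\mathcal{OPT}$ is a schedule minimizing $F$. Job $J_i$ is active at time $t$ under $\mathcal{S}$ if $r_i\le t<c_i(\mathcal{S})$; for active $i$, $q_{t,\mathcal{S}}(i)$ is the number of tasks of $J_i$ not executed in slots $[0],\dots,[t-1]$, and $0$ otherwise. SRPT: fix a schedule $\mathcal{SRPT}$ that in each slot $[t]$ executes an active job with the smallest remaining processing time (ties broken by a fixed rule). Let $M_{SRPT}(t)$ be the set of tasks executed in slots $[0],\dots,[t]$ under $\mathcal{SRPT}$. Algorithm $BAL(\theta)$: let $q_t(i)=q_{t,\mathcal{BAL}}(i)$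 and $M_{BAL}(t)$ the set of tasks executed by $BAL(\theta)$ in slots $[0],\dots,[t]$, $M_{BAL}(-1)=\varnothing$. Every job is initially normal. At each $t=0,1,2,\dots$: first, every active, not-yet-starving job $J_i$ with $(t-r_i)/q_t(i)\ge\theta$ becomes starving, recording $t_i=t$ and $\gamma_i=(t-r_i)/q_t(i)$ (a job stays starving until it completes). Then, if some active job is starving, slot $[t]$ executes the starving active job with smallest $t_i$, ties broken by largest $\gamma_i$, then smallest index. Otherwise, if $M_{SRPT}(t)\setminus M_{BAL}(t-1)\ne\varnothing$, slot $[t]$ executes, among the tasks in $M_{SRPT}(t)\setminus M_{BAL}(t-1)$, the one with the smallest completion time under $\mathcal{SRPT}$. $\mathcal{BAL}$ denotes the resulting schedule. For a job that never becomes starving define $t_i=c_i(\mathcal{BAL})$. For every job define $\mathrm{starv}_i(\theta)=c_i(\mathcal{BAL})-t_i$. *)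

theory Defs
  imports Complex_Main
begin

text \<open>
  An instance is given by the number \<open>n\<close> of jobs, release times \<open>r\<close> and processing times \<open>p\<close>;
  jobs are numbered \<open>0, \<dots>, n - 1\<close>. A schedule maps slot \<open>[t, t + 1)\<close> to the job executed in it,
  or to \<open>None\<close> if the slot is idle.
\<close>

type_synonym sched = "nat \<Rightarrow> nat option"

definition schedule :: "nat \<Rightarrow> (nat \<Rightarrow> nat) \<Rightarrow> (nat \<Rightarrow> nat) \<Rightarrow> sched \<Rightarrow> bool" where
  "schedule n r p S \<longleftrightarrow>
     (\<forall>t i. S t = Some i \<longrightarrow> i < n \<and> r i \<le> t) \<and>
     (\<forall>i<n. finite {t. S t = Some i} \<and> card {t. S t = Some i} = p i)"

definition completion :: "sched \<Rightarrow> nat \<Rightarrow> nat" where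
  "completion S i = Suc (Max {t. S t = Some i})"

definition flow :: "(nat \<Rightarrow> nat) \<Rightarrow> sched \<Rightarrow> nat \<Rightarrow> real" where
  "flow r S i = real (completion S i) - real (r i)"

definition cost :: "nat \<Rightarrow> (nat \<Rightarrow> nat) \<Rightarrow> sched \<Rightarrow> real" where
  "cost n r S = (\<Sum>i<n. (flow r S i)\<^sup>2)"

definition optimal :: "nat \<Rightarrow> (nat \<Rightarrow> nat) \<Rightarrow> (nat \<Rightarrow> nat) \<Rightarrow> sched \<Rightarrow> bool" where
  "optimal n r p S \<longleftrightarrow>
     schedule n r p S \<and> (\<forall>S'. schedule n r p S' \<longrightarrow> cost n r S \<le> cost n r S')"

definition executed :: "sched \<Rightarrow> nat \<Rightarrow> nat \<Rightarrow> nat" where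
  "executed S t i = card {s. s < t \<and> S s = Some i}"

text \<open>
  Being active at time \<open>t\<close> is phrased through the slots before \<open>t\<close> only, so that an online
  algorithm can refer to it while its schedule is still under construction. For a schedule it
  means \<open>r i \<le> t < completion S i\<close>, see \<open>active_iff\<close> below.
\<close>

definition active :: "nat \<Rightarrow> (nat \<Rightarrow> nat) \<Rightarrow> (nat \<Rightarrow> nat) \<Rightarrow> sched \<Rightarrow> nat \<Rightarrow> nat \<Rightarrow> bool" where
  "active n r p S t i \<longleftrightarrow> i < n \<and> r i \<le> t \<and> executed S t i < p i"

definition remaining :: "nat \<Rightarrow> (nat \<Rightarrow> nat) \<Rightarrow> (nat \<Rightarrow> nat) \<Rightarrow> sched \<Rightarrow> nat \<Rightarrow> nat \<Rightarrow> nat" where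
  "remaining n r p S t i = (if active n r p S t i then p i - executed S t i else 0)"

lemma active_iff:
  assumes S: "schedule n r p S" and i: "i < n" and p: "p i \<ge> 1"
  shows "active n r p S t i \<longleftrightarrow> r i \<le> t \<and> t < completion S i"
proof -
  let ?A = "{s. S s = Some i}"
  have fin: "finite ?A" and card: "card ?A = p i"
    using S i unfolding schedule_def by blast+
  have ne: "?A \<noteq> {}"
  proof
    assume "?A = {}"
    then have "card ?A = 0" by (simp only: card.empty)
    then show False using card p by linarith
  qed
  let ?E = "{s. s < t \<and> S s = Some i}"
  have sub: "?E \<subseteq> ?A" by blast
  have "executed S t i < p i \<longleftrightarrow> card ?E < card ?A" by (simp add: executed_def card)
  also have "\<dots> \<longleftrightarrow> ?E \<noteq> ?A"
  proof
    assume "?E \<noteq> ?A"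
    with sub have "?E \<subset> ?A" by (rule psubsetI)
    then show "card ?E < card ?A" by (rule psubset_card_mono[OF fin])
  next
    assume "card ?E < card ?A"
    then show "?E \<noteq> ?A" by (metis less_irrefl)
  qed
  also have "\<dots> \<longleftrightarrow> \<not> ?A \<subseteq> ?E" using sub by blast
  also have "\<dots> \<longleftrightarrow> (\<exists>s\<in>?A. \<not> s < t)" by blast
  also have "\<dots> \<longleftrightarrow> (\<exists>s\<in>?A. t \<le> s)" by (simp only: not_less)
  also have "\<dots> \<longleftrightarrow> t \<le> Max ?A" using fin ne by (simp add: Max_ge_iff)
  finally show ?thesis using i by (auto simp: active_def completion_def less_Suc_eq_le)
qed

text \<open>
  Ties are left open: the predicate holds for the schedule produced by any tie-breaking rule.
\<close>

definition is_srpt :: "nat \<Rightarrow> (nat \<Rightarrow> nat) \<Rightarrow> (nat \<Rightarrow> nat) \<Rightarrow> sched \<Rightarrow> bool" where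
  "is_srpt n r p S \<longleftrightarrow>
     schedule n r p S \<and>
     (\<forall>t. (\<exists>i. active n r p S t i) \<longrightarrow>
        (\<exists>i. S t = Some i \<and> active n r p S t i \<and>
           (\<forall>j. active n r p S t j \<longrightarrow> remaining n r p S t i \<le> remaining n r p S t j)))"

text \<open>
  The pair \<open>(i, k)\<close> with \<open>k \<ge> 1\<close> is the \<open>k\<close>-th unit task of job \<open>i\<close>. Since \<open>tasks_before S t\<close>
  collects the slots strictly before \<open>t\<close>, the set \<open>M(t)\<close> of tasks executed in the slots
  \<open>0, \<dots>, t\<close> is \<open>tasks_before S (Suc t)\<close>, and \<open>M(t - 1)\<close> is \<open>tasks_before S t\<close>, also for \<open>t = 0\<close>.
\<close>

definition task_at :: "sched \<Rightarrow> nat \<Rightarrow> (nat \<times> nat) option" where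
  "task_at S t = map_option (\<lambda>i. (i, Suc (executed S t i))) (S t)"

definition tasks_before :: "sched \<Rightarrow> nat \<Rightarrow> (nat \<times> nat) set" where
  "tasks_before S t = {x. \<exists>s<t. task_at S s = Some x}"

definition task_completion :: "sched \<Rightarrow> nat \<times> nat \<Rightarrow> nat" where
  "task_completion S x = Suc (THE s. task_at S s = Some x)"

definition age_ratio :: "nat \<Rightarrow> (nat \<Rightarrow> nat) \<Rightarrow> (nat \<Rightarrow> nat) \<Rightarrow> sched \<Rightarrow> nat \<Rightarrow> nat \<Rightarrow> real" where
  "age_ratio n r p S t i = (real t - real (r i)) / real (remaining n r p S t i)"

definition triggered ::
  "nat \<Rightarrow> (nat \<Rightarrow> nat) \<Rightarrow> (nat \<Rightarrow> nat) \<Rightarrow> real \<Rightarrow> sched \<Rightarrow> nat \<Rightarrow> nat \<Rightarrow> bool" where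
  "triggered n r p \<theta> S t i \<longleftrightarrow> active n r p S t i \<and> age_ratio n r p S t i \<ge> \<theta>"

text \<open>
  A job starts to starve the first time it is triggered: \<open>onset\<close> and \<open>onset_ratio\<close> are the values
  \<open>t\<^sub>i\<close> and \<open>\<gamma>\<^sub>i\<close> recorded then. They are meaningful only for jobs that are triggered at some time;
  \<open>starve_time\<close> below extends \<open>t\<^sub>i\<close> to the other jobs.
\<close>

definition onset ::
  "nat \<Rightarrow> (nat \<Rightarrow> nat) \<Rightarrow> (nat \<Rightarrow> nat) \<Rightarrow> real \<Rightarrow> sched \<Rightarrow> nat \<Rightarrow> nat" where
  "onset n r p \<theta> S i = (LEAST t. triggered n r p \<theta> S t i)"

definition onset_ratio ::
  "nat \<Rightarrow> (nat \<Rightarrow> nat) \<Rightarrow> (nat \<Rightarrow> nat) \<Rightarrow> real \<Rightarrow> sched \<Rightarrow> nat \<Rightarrow> real" where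
  "onset_ratio n r p \<theta> S i = age_ratio n r p S (onset n r p \<theta> S i) i"

definition starving ::
  "nat \<Rightarrow> (nat \<Rightarrow> nat) \<Rightarrow> (nat \<Rightarrow> nat) \<Rightarrow> real \<Rightarrow> sched \<Rightarrow> nat \<Rightarrow> nat \<Rightarrow> bool" where
  "starving n r p \<theta> S t i \<longleftrightarrow>
     active n r p S t i \<and> (\<exists>s\<le>t. triggered n r p \<theta> S s i)"

definition precedes ::
  "nat \<Rightarrow> (nat \<Rightarrow> nat) \<Rightarrow> (nat \<Rightarrow> nat) \<Rightarrow> real \<Rightarrow> sched \<Rightarrow> nat \<Rightarrow> nat \<Rightarrow> bool" where
  "precedes n r p \<theta> S i j \<longleftrightarrow>
     onset n r p \<theta> S i < onset n r p \<theta> S j \<or>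
     onset n r p \<theta> S i = onset n r p \<theta> S j \<and>
       (onset_ratio n r p \<theta> S i > onset_ratio n r p \<theta> S j \<or>
        onset_ratio n r p \<theta> S i = onset_ratio n r p \<theta> S j \<and> i < j)"

definition bal_choice ::
  "nat \<Rightarrow> (nat \<Rightarrow> nat) \<Rightarrow> (nat \<Rightarrow> nat) \<Rightarrow> real \<Rightarrow> sched \<Rightarrow> sched \<Rightarrow> nat \<Rightarrow> nat option" where
  "bal_choice n r p \<theta> srpt S t =
     (if \<exists>i. starving n r p \<theta> S t i then
        Some (THE i. starving n r p \<theta> S t i \<and>
                (\<forall>j. starving n r p \<theta> S t j \<and> j \<noteq> i \<longrightarrow> precedes n r p \<theta> S i j))
      else if tasks_before srpt (Suc t) - tasks_before S t \<noteq> {} then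
        Some (fst (ARG_MIN (task_completion srpt) x.
                x \<in> tasks_before srpt (Suc t) - tasks_before S t))
      else None)"

text \<open>
  The schedule produced by \<open>BAL(\<theta>)\<close>: the decision for slot \<open>t\<close> is taken on the part of the
  schedule before \<open>t\<close>. By \<open>bal_step\<close> below this is the same as the recursion
  \<open>bal t = bal_choice bal t\<close>, and by \<open>schedule_bal\<close> the result is indeed a schedule.
\<close>

function bal ::
  "nat \<Rightarrow> (nat \<Rightarrow> nat) \<Rightarrow> (nat \<Rightarrow> nat) \<Rightarrow> real \<Rightarrow> sched \<Rightarrow> sched" where
  "bal n r p \<theta> srpt t =
     bal_choice n r p \<theta> srpt (\<lambda>s. if s < t then bal n r p \<theta> srpt s else None) t"
  by pat_completeness auto
termination by (relation "measure (\<lambda>(n, r, p, \<theta>, srpt, t). t)") auto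

declare bal.simps [simp del]

definition starve_time ::
  "nat \<Rightarrow> (nat \<Rightarrow> nat) \<Rightarrow> (nat \<Rightarrow> nat) \<Rightarrow> real \<Rightarrow> sched \<Rightarrow> nat \<Rightarrow> nat" where
  "starve_time n r p \<theta> S i =
     (if \<exists>t. triggered n r p \<theta> S t i then onset n r p \<theta> S i else completion S i)"

definition starv ::
  "nat \<Rightarrow> (nat \<Rightarrow> nat) \<Rightarrow> (nat \<Rightarrow> nat) \<Rightarrow> real \<Rightarrow> sched \<Rightarrow> nat \<Rightarrow> real" where
  "starv n r p \<theta> srpt i =
     real (completion (bal n r p \<theta> srpt) i)
       - real (starve_time n r p \<theta> (bal n r p \<theta> srpt) i)"


subsection \<open>The schedule of \<open>BAL\<close> is well defined\<close>

lemma executed_cong: "(\<And>s. s < t \<Longrightarrow> S s = S' s) \<Longrightarrow> executed S t i = executed S' t i"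
  unfolding executed_def by (rule arg_cong[where f = card]) auto

lemma executed_0 [simp]: "executed S 0 i = 0"
  by (simp add: executed_def)

lemma executed_Suc: "executed S (Suc t) i = executed S t i + (if S t = Some i then 1 else 0)"
proof -
  have "{s. s < Suc t \<and> S s = Some i} =
      (if S t = Some i then insert t {s. s < t \<and> S s = Some i} else {s. s < t \<and> S s = Some i})"
    by (auto simp: less_Suc_eq)
  then show ?thesis by (auto simp: executed_def)
qed

lemma bal_choice_cong:
  assumes eq: "\<And>s. s < t \<Longrightarrow> S s = S' s"
  shows "bal_choice n r p \<theta> srpt S t = bal_choice n r p \<theta> srpt S' t"
proof -
  have ex: "executed S s i = executed S' s i" if "s \<le> t" for s i
    using that by (intro executed_cong eq) auto
  have ac: "active n r p S s i = active n r p S' s i" if "s \<le> t" for s i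
    using ex[OF that] by (simp add: active_def)
  have ar: "age_ratio n r p S s i = age_ratio n r p S' s i" if "s \<le> t" for s i
    using ex[OF that] ac[OF that] by (simp add: age_ratio_def remaining_def)
  have tr: "triggered n r p \<theta> S s i = triggered n r p \<theta> S' s i" if "s \<le> t" for s i
    using ac[OF that] ar[OF that] by (simp add: triggered_def)
  have st: "starving n r p \<theta> S t i = starving n r p \<theta> S' t i" for i
    using ac tr by (auto simp: starving_def)
  have on: "onset n r p \<theta> S i = onset n r p \<theta> S' i \<and> onset n r p \<theta> S i \<le> t"
    if "starving n r p \<theta> S t i" for i
  proof -
    obtain s where s: "s \<le> t" "triggered n r p \<theta> S s i"
      using \<open>starving n r p \<theta> S t i\<close> by (auto simp: starving_def)
    let ?l = "onset n r p \<theta> S i"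
    have l: "triggered n r p \<theta> S ?l i" "?l \<le> t"
      using s LeastI[of "\<lambda>s. triggered n r p \<theta> S s i"]
        Least_le[of "\<lambda>s. triggered n r p \<theta> S s i"] by (auto simp: onset_def intro: order.trans)
    have "onset n r p \<theta> S' i = ?l"
      unfolding onset_def[of _ _ _ _ S']
    proof (rule Least_equality)
      show "triggered n r p \<theta> S' ?l i" using l tr by blast
      fix y assume y: "triggered n r p \<theta> S' y i"
      show "?l \<le> y"
      proof (cases "y \<le> t")
        case True
        then show ?thesis using y tr by (auto simp: onset_def intro: Least_le)
      qed (use l in simp)
    qed
    with l show ?thesis by simp
  qed
  have orat: "onset_ratio n r p \<theta> S i = onset_ratio n r p \<theta> S' i"
    if "starving n r p \<theta> S t i" for i
    using on[OF that] ar by (simp add: onset_ratio_def)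
  have pr: "precedes n r p \<theta> S i j = precedes n r p \<theta> S' i j"
    if "starving n r p \<theta> S t i" "starving n r p \<theta> S t j" for i j
    using on[OF that(1)] on[OF that(2)] orat[OF that(1)] orat[OF that(2)]
    by (simp add: precedes_def)
  have the: "(\<lambda>i. starving n r p \<theta> S t i \<and>
        (\<forall>j. starving n r p \<theta> S t j \<and> j \<noteq> i \<longrightarrow> precedes n r p \<theta> S i j)) =
      (\<lambda>i. starving n r p \<theta> S' t i \<and>
        (\<forall>j. starving n r p \<theta> S' t j \<and> j \<noteq> i \<longrightarrow> precedes n r p \<theta> S' i j))"
    by (rule ext) (use pr st in blast)
  have tk: "task_at S s = task_at S' s" if "s < t" for s
    using that ex[of s] eq[of s] by (cases "S' s") (auto simp: task_at_def)
  have tb: "tasks_before S t = tasks_before S' t"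
    using tk by (auto simp: tasks_before_def)
  have "(\<exists>i. starving n r p \<theta> S t i) = (\<exists>i. starving n r p \<theta> S' t i)"
    by (simp only: st)
  then show ?thesis unfolding bal_choice_def the tb by (simp only:)
qed

lemma bal_step: "bal n r p \<theta> srpt t = bal_choice n r p \<theta> srpt (bal n r p \<theta> srpt) t"
  by (subst bal.simps, rule bal_choice_cong) simp

text \<open>The priority among starving jobs is a strict total order, so \<open>THE\<close> picks a starving job.\<close>

lemma starving_choice:
  assumes "\<exists>i. starving n r p \<theta> S t i"
  shows "\<exists>!i. starving n r p \<theta> S t i \<and>
    (\<forall>j. starving n r p \<theta> S t j \<and> j \<noteq> i \<longrightarrow> precedes n r p \<theta> S i j)"
proof -
  let ?lt = "precedes n r p \<theta> S"
  let ?A = "{i. starving n r p \<theta> S t i}"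
  have tot: "?lt i j \<or> ?lt j i" if "i \<noteq> j" for i j
    using that unfolding precedes_def by linarith
  have asym: "\<not> (?lt i j \<and> ?lt j i)" for i j
    unfolding precedes_def by linarith
  have trans: "?lt i k" if "?lt i j" "?lt j k" for i j k
    using that unfolding precedes_def by linarith
  have fin: "finite ?A"
    by (rule finite_subset[of _ "{..<n}"]) (auto simp: starving_def active_def)
  have "finite A \<Longrightarrow> A \<noteq> {} \<Longrightarrow> \<exists>i\<in>A. \<forall>j\<in>A. j \<noteq> i \<longrightarrow> ?lt i j" for A
  proof (induction A rule: finite_ne_induct)
    case (insert x F)
    then obtain i where i: "i \<in> F" "\<forall>j\<in>F. j \<noteq> i \<longrightarrow> ?lt i j" by blast
    have "x \<noteq> i" using i insert by blast
    then consider "?lt x i" | "?lt i x" using tot by blast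
    then show ?case
    proof cases
      case 1
      then have "?lt x j" if "j \<in> F" for j using that i trans by (cases "j = i") blast+
      then show ?thesis by blast
    next
      case 2
      then show ?thesis using i by blast
    qed
  qed simp
  from this[OF fin] assms show ?thesis using asym by blast
qed

lemma mem_tasks_before: "(i, k) \<in> tasks_before S t \<longleftrightarrow> 1 \<le> k \<and> k \<le> executed S t i"
proof (induction t)
  case (Suc t)
  have "(i, k) \<in> tasks_before S (Suc t) \<longleftrightarrow>
      (i, k) \<in> tasks_before S t \<or> task_at S t = Some (i, k)"
    by (auto simp: tasks_before_def less_Suc_eq)
  also have "\<dots> \<longleftrightarrow> 1 \<le> k \<and> k \<le> executed S (Suc t) i"
    using Suc by (cases "S t") (auto simp: task_at_def executed_Suc)
  finally show ?case .
qed (auto simp: tasks_before_def)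

lemma task_at_unique:
  assumes "task_at S s = Some x" "task_at S t = Some x"
  shows "s = t"
proof -
  have *: False if "s < t" "task_at S s = Some x" "task_at S t = Some x" for s t
  proof -
    obtain i k where x: "x = (i, k)" by force
    have "(i, k) \<in> tasks_before S t" using that x by (auto simp: tasks_before_def)
    then have "k \<le> executed S t i" by (simp add: mem_tasks_before)
    moreover have "k = Suc (executed S t i)" using that x by (auto simp: task_at_def)
    ultimately show False by simp
  qed
  show ?thesis using *[of s t] *[of t s] assms by (metis linorder_neqE_nat)
qed

lemma task_completion_eq: "task_at S s = Some x \<Longrightarrow> task_completion S x = Suc s"
  unfolding task_completion_def by (simp add: the_equality task_at_unique)

text \<open>
  In a non-starving slot the job chosen by \<open>BAL\<close> executes exactly the task selected by the rule.
\<close>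

lemma task_choice:
  assumes "tasks_before srpt (Suc t) - tasks_before S t \<noteq> {}"
  defines "x \<equiv> ARG_MIN (task_completion srpt) x. x \<in> tasks_before srpt (Suc t) - tasks_before S t"
  shows "x \<in> tasks_before srpt (Suc t)" "x = (fst x, Suc (executed S t (fst x)))"
proof -
  let ?D = "tasks_before srpt (Suc t) - tasks_before S t"
  obtain y where "y \<in> ?D" using assms(1) by blast
  then have x: "x \<in> ?D" and least: "\<And>y. y \<in> ?D \<Longrightarrow> task_completion srpt x \<le> task_completion srpt y"
    unfolding x_def using arg_min_nat_lemma[of "\<lambda>x. x \<in> ?D" y "task_completion srpt"] by auto
  then show "x \<in> tasks_before srpt (Suc t)" by simp
  obtain i k where ik: "x = (i, k)" by force
  obtain s where s: "s < Suc t" "task_at srpt s = Some x"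
    using x by (auto simp: tasks_before_def)
  have k: "k = Suc (executed srpt s i)" using s ik by (auto simp: task_at_def)
  have gt: "executed S t i < k" using x ik k by (auto simp: mem_tasks_before)
  have "k = Suc (executed S t i)"
  proof (rule ccontr)
    let ?y = "(i, Suc (executed S t i))"
    assume "k \<noteq> Suc (executed S t i)"
    with gt k have "?y \<in> tasks_before srpt s" by (auto simp: mem_tasks_before)
    then obtain s' where s': "s' < s" "task_at srpt s' = Some ?y"
      by (auto simp: tasks_before_def)
    then have "?y \<in> ?D" using s
      by (auto simp: mem_tasks_before tasks_before_def[of srpt] intro: less_trans)
    from least[OF this] show False
      using s' s by (simp add: task_completion_eq)
  qed
  then show "x = (fst x, Suc (executed S t (fst x)))" using ik by simp
qed

lemma schedule_executed_le:
  assumes "schedule n r p S" "i < n"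
  shows "executed S t i \<le> p i"
proof -
  have "finite {t. S t = Some i}" "card {t. S t = Some i} = p i"
    using assms unfolding schedule_def by blast+
  then show ?thesis unfolding executed_def by (metis (mono_tags, lifting) Collect_mono card_mono)
qed

lemma bal_active:
  assumes S: "is_srpt n r p srpt" and t: "bal n r p \<theta> srpt t = Some i"
  shows "active n r p (bal n r p \<theta> srpt) t i"
proof (cases "\<exists>i. starving n r p \<theta> (bal n r p \<theta> srpt) t i")
  case True
  then show ?thesis
    using theI'[OF starving_choice[OF True]] t by (auto simp: bal_step[of _ _ _ _ _ t] bal_choice_def starving_def)
next
  case False
  let ?D = "tasks_before srpt (Suc t) - tasks_before (bal n r p \<theta> srpt) t"
  let ?x = "ARG_MIN (task_completion srpt) x. x \<in> ?D"
  have D: "?D \<noteq> {}" and i: "i = fst ?x"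
    using t False by (auto simp: bal_step[of _ _ _ _ _ t] bal_choice_def split: if_splits)
  have sch: "schedule n r p srpt" using S by (simp add: is_srpt_def)
  have mem: "(i, Suc (executed (bal n r p \<theta> srpt) t i)) \<in> tasks_before srpt (Suc t)"
    using task_choice[OF D] i by metis
  then obtain s where s: "s < Suc t" "srpt s = Some i"
    by (auto simp: tasks_before_def task_at_def)
  have "i < n" "r i \<le> t" using s sch by (force simp: schedule_def)+
  moreover have "executed (bal n r p \<theta> srpt) t i < p i"
    using mem schedule_executed_le[OF sch \<open>i < n\<close>, of "Suc t"] by (simp add: mem_tasks_before)
  ultimately show ?thesis by (simp add: active_def)
qed

lemma bal_executed_le:
  assumes "is_srpt n r p srpt"
  shows "executed (bal n r p \<theta> srpt) t i \<le> p i"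
proof (induction t)
  case (Suc t)
  show ?case
  proof (cases "bal n r p \<theta> srpt t = Some i")
    case True
    from bal_active[OF assms this] show ?thesis using True by (simp add: executed_Suc active_def)
  qed (use Suc in \<open>simp add: executed_Suc\<close>)
qed simp

lemma bal_executed_early:
  assumes "is_srpt n r p srpt" "t \<le> r i"
  shows "executed (bal n r p \<theta> srpt) t i = 0"
  using assms(2)
proof (induction t)
  case (Suc t)
  have "bal n r p \<theta> srpt t \<noteq> Some i"
  proof
    assume "bal n r p \<theta> srpt t = Some i"
    from bal_active[OF assms(1) this] show False using Suc.prems by (simp add: active_def)
  qed
  then show ?case using Suc by (simp add: executed_Suc)
qed simp

definition work :: "nat \<Rightarrow> sched \<Rightarrow> nat \<Rightarrow> nat" where
  "work n S t = (\<Sum>i<n. executed S t i)"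

lemma work_Suc:
  assumes "\<And>i. S t = Some i \<Longrightarrow> i < n"
  shows "work n S (Suc t) = work n S t + (if S t = None then 0 else 1)"
proof (cases "S t")
  case (Some i)
  then have "i < n" using assms by blast
  then show ?thesis using Some by (simp add: work_def executed_Suc sum.distrib)
qed (simp add: work_def executed_Suc)

lemma work_bal_le:
  assumes S: "is_srpt n r p srpt"
  shows "work n (bal n r p \<theta> srpt) t \<le> work n srpt t"
proof (induction t)
  case (Suc t)
  let ?B = "bal n r p \<theta> srpt"
  have sch: "schedule n r p srpt" using S by (simp add: is_srpt_def)
  have B: "work n ?B (Suc t) = work n ?B t + (if ?B t = None then 0 else 1)"
    by (rule work_Suc) (use bal_active[OF S] in \<open>auto simp: active_def\<close>)
  have W: "work n srpt (Suc t) = work n srpt t + (if srpt t = None then 0 else 1)"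
    by (rule work_Suc) (use sch in \<open>auto simp: schedule_def\<close>)
  show ?case
  proof (cases "srpt t")
    case None
    then have na: "\<not> active n r p srpt t i" for i using S by (force simp: is_srpt_def)
    have "work n ?B (Suc t) \<le> work n srpt t"
      unfolding work_def
    proof (rule sum_mono)
      fix i assume "i \<in> {..<n}"
      then show "executed ?B (Suc t) i \<le> executed srpt t i"
        using na[of i] bal_executed_le[OF S, of \<theta> "Suc t" i] bal_executed_early[OF S, of "Suc t" i \<theta>]
        by (auto simp: active_def not_le not_less)
    qed
    then show ?thesis using W None by simp
  qed (use B W Suc in auto)
qed (simp add: work_def)

text \<open>\<open>BAL\<close> never idles while some job is active.\<close>

lemma bal_busy:
  assumes S: "is_srpt n r p srpt" and a: "active n r p (bal n r p \<theta> srpt) t i"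
  shows "bal n r p \<theta> srpt t \<noteq> None"
proof
  let ?B = "bal n r p \<theta> srpt"
  assume None: "?B t = None"
  then have D: "tasks_before srpt (Suc t) \<subseteq> tasks_before ?B t"
    by (auto simp: bal_step[of _ _ _ _ _ t] bal_choice_def split: if_splits)
  have le: "executed srpt (Suc t) j \<le> executed ?B t j" for j
  proof (cases "executed srpt (Suc t) j")
    case (Suc m)
    then have "(j, Suc m) \<in> tasks_before srpt (Suc t)" by (simp add: mem_tasks_before)
    then have "(j, Suc m) \<in> tasks_before ?B t" using D by blast
    then show ?thesis using Suc by (simp add: mem_tasks_before)
  qed simp
  have W: "work n srpt (Suc t) = work n srpt t + (if srpt t = None then 0 else 1)"
    by (rule work_Suc) (use S in \<open>auto simp: is_srpt_def schedule_def\<close>)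
  have WB: "work n srpt (Suc t) \<le> work n ?B t" using le by (auto simp: work_def intro: sum_mono)
  with W work_bal_le[OF S, of \<theta> t] have "srpt t = None" by (auto split: if_splits)
  then have na: "\<not> active n r p srpt t i" using S by (force simp: is_srpt_def)
  have i: "i < n" "r i \<le> t" "executed ?B t i < p i" using a by (auto simp: active_def)
  have "p i \<le> executed srpt t i" using na i by (simp add: active_def)
  also have "\<dots> \<le> executed srpt (Suc t) i" by (simp add: executed_Suc)
  also have "\<dots> \<le> executed ?B t i" by (rule le)
  finally show False using i by simp
qed

theorem schedule_bal:
  assumes S: "is_srpt n r p srpt"
  shows "schedule n r p (bal n r p \<theta> srpt)"
proof -
  let ?B = "bal n r p \<theta> srpt"
  have ok: "i < n \<and> r i \<le> t" if "?B t = Some i" for t i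
    using bal_active[OF S that] by (simp add: active_def)
  have fin: "finite {t. ?B t = Some i} \<and> card {t. ?B t = Some i} = p i" if i: "i < n" for i
  proof -
    have bound: "work n ?B t \<le> (\<Sum>i<n. p i)" for t
      unfolding work_def by (intro sum_mono bal_executed_le[OF S])
    have "\<exists>t\<ge>r i. executed ?B t i = p i"
    proof (rule ccontr)
      assume "\<not> ?thesis"
      then have "active n r p ?B t i" if "r i \<le> t" for t
        using that i bal_executed_le[OF S, of \<theta> t i] by (auto simp: active_def le_less)
      then have busy: "?B t \<noteq> None" if "r i \<le> t" for t
        using that bal_busy[OF S] by blast
      have "m \<le> work n ?B (r i + m)" for m
      proof (induction m)
        case (Suc m)
        then show ?case using busy[of "r i + m"] work_Suc[of ?B "r i + m" n] ok by auto
      qed simp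
      from this[of "Suc (\<Sum>i<n. p i)"] bound show False by (meson not_less_eq_eq order.trans)
    qed
    then obtain t where t: "executed ?B t i = p i" by blast
    have none: "?B s \<noteq> Some i" if "t \<le> s" for s
    proof
      assume s: "?B s = Some i"
      have "executed ?B t i \<le> executed ?B s i"
        unfolding executed_def using that by (intro card_mono) auto
      then show False using bal_active[OF S s] t by (simp add: active_def)
    qed
    then have "{s. ?B s = Some i} = {s. s < t \<and> ?B s = Some i}" by (auto simp: not_le[symmetric])
    then show ?thesis using t by (simp add: executed_def)
  qed
  show ?thesis using ok fin by (simp add: schedule_def)
qed

end

theory Submission
  imports Defs "HOL-Analysis.Convex"
begin

text \<open>
  Each single \<open>starv\<^sub>i\<^sup>2\<close> is already \<open>O(F / \<surd>\<theta>)\<close>. Since starving jobs are served first come first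
  served, \<open>starv\<^sub>i\<close> is at most the remaining work of the jobs that starve at \<open>t\<^sub>i\<close>, each of which has an
  age of at least \<open>\<theta>\<close> times its remaining time. Up to a factor of two, this work is bounded by
  the sum of \<open>z\<^sub>j = min y\<^sub>j ((t\<^sub>i - r\<^sub>j) / \<theta>)\<close>, where \<open>y\<^sub>j\<close> is the remaining time of \<open>J\<^sub>j\<close> under SRPT
  at time \<open>t\<^sub>i\<close>. So it remains to bound \<open>\<Sum> z\<^sub>j\<close> by the cost of an arbitrary schedule, which works
  because SRPT has the least and the most unevenly distributed remaining work of all schedules.
\<close>

subsection \<open>Remaining processing times\<close>

lemma executed_mono: "s \<le> t \<Longrightarrow> executed S s i \<le> executed S t i"
  unfolding executed_def by (intro card_mono) auto

lemma remaining_eq: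
  "i < n \<Longrightarrow> remaining n r p S t i = (if r i \<le> t then p i - executed S t i else 0)"
  by (auto simp: remaining_def active_def)

lemma executed_early:
  assumes "schedule n r p S" "t \<le> r i"
  shows "executed S t i = 0"
proof -
  have "{s. s < t \<and> S s = Some i} = {}"
    using assms by (force simp: schedule_def)
  then show ?thesis by (simp add: executed_def del: Collect_empty_eq)
qed

text \<open>As \<open>remaining\<close> is 0 before release, an arrival is an additive jump by
  \<open>p i\<close> that is the same for every schedule.\<close>

lemma remaining_Suc:
  assumes S: "schedule n r p S" and i: "i < n"
  shows "remaining n r p S (Suc t) i =
    remaining n r p S t i - (if S t = Some i then 1 else 0) + (if r i = Suc t then p i else 0)"
  using executed_early[OF S, of "Suc t" i] S
  by (auto simp: remaining_eq[OF i] executed_Suc schedule_def le_Suc_eq)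

lemma card_future_slots:
  assumes "schedule n r p S" "i < n"
  shows "finite {s. t \<le> s \<and> S s = Some i}"
    and "executed S t i + card {s. t \<le> s \<and> S s = Some i} = p i"
proof -
  let ?A = "{s. S s = Some i}"
  have fin: "finite ?A" and card: "card ?A = p i"
    using assms unfolding schedule_def by blast+
  show "finite {s. t \<le> s \<and> S s = Some i}"
    by (rule finite_subset[OF _ fin]) auto
  have eq: "?A = {s. s < t \<and> S s = Some i} \<union> {s. t \<le> s \<and> S s = Some i}" by auto
  have "card ?A = card {s. s < t \<and> S s = Some i} + card {s. t \<le> s \<and> S s = Some i}"
    unfolding eq by (rule card_Un_disjoint) (auto intro: finite_subset[OF _ fin])
  then show "executed S t i + card {s. t \<le> s \<and> S s = Some i} = p i"
    using card by (simp add: executed_def)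
qed

lemma remaining_le_card_future_slots:
  assumes "schedule n r p S" "i < n"
  shows "remaining n r p S t i \<le> card {s. t \<le> s \<and> S s = Some i}"
proof -
  have "remaining n r p S t i \<le> p i - executed S t i" by (simp add: remaining_eq[OF assms(2)])
  then show ?thesis using card_future_slots(2)[OF assms, of t] by linarith
qed

lemma less_completion:
  assumes "schedule n r p S" "i < n" "S s = Some i"
  shows "s < completion S i"
proof -
  have "finite {t. S t = Some i}" using assms unfolding schedule_def by blast
  then show ?thesis using assms(3) by (simp add: completion_def less_Suc_eq_le)
qed

text \<open>The remaining units occupy distinct slots, all inside
  \<open>{t..<t + h}\<close>.\<close>

lemma sum_remaining_le:
  assumes S: "schedule n r p S" and A: "A \<subseteq> {..<n}"
    and c: "\<And>i. i \<in> A \<Longrightarrow> completion S i \<le> t + h"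
  shows "(\<Sum>i\<in>A. remaining n r p S t i) \<le> h"
proof -
  have fin: "finite A" using A finite_subset by blast
  have "(\<Sum>i\<in>A. remaining n r p S t i) \<le> (\<Sum>i\<in>A. card {s. t \<le> s \<and> S s = Some i})"
    using A by (intro sum_mono remaining_le_card_future_slots[OF S]) auto
  also have "\<dots> = card (\<Union>i\<in>A. {s. t \<le> s \<and> S s = Some i})"
    by (rule card_UN_disjoint[symmetric])
      (use fin A card_future_slots(1)[OF S] in \<open>auto\<close>)
  also have "\<dots> \<le> card {t..<t + h}"
    using A c less_completion[OF S] by (intro card_mono) (fastforce intro: less_le_trans)+
  finally show ?thesis by simp
qed

lemma release_less_completion:
  assumes S: "schedule n r p S" and i: "i < n" "1 \<le> p i"
  shows "r i < completion S i"
proof -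
  have "card {t. S t = Some i} = p i" using S i unfolding schedule_def by blast
  then have "{t. S t = Some i} \<noteq> {}" using i by (metis card.empty not_one_le_zero)
  then obtain s where s: "S s = Some i" by blast
  then have "r i \<le> s" using S by (auto simp: schedule_def)
  then show ?thesis using less_completion[OF S i(1) s] by simp
qed

text \<open>\<open>remaining\<close> is nonzero only in the slots between release and completion.
  Their number is the flow time, which also bounds \<open>remaining\<close> in each of them.\<close>

lemma sum_remaining_le_square_flow:
  assumes S: "schedule n r p S" and i: "i < n" "1 \<le> p i"
  shows "(\<Sum>s<t. real (remaining n r p S s i)) \<le> (flow r S i)\<^sup>2"
proof -
  let ?I = "{r i..<completion S i}"
  let ?f = "completion S i - r i"
  have le: "remaining n r p S s i \<le> (if s \<in> ?I then ?f else 0)" for s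
  proof (cases "s \<in> ?I")
    case True
    then show ?thesis
      using sum_remaining_le[OF S, of "{i}" s "completion S i - s"] i by auto
  next
    case False
    then show ?thesis using active_iff[OF S i, of s] by (auto simp: remaining_def)
  qed
  have "(\<Sum>s<t. remaining n r p S s i) \<le> (\<Sum>s<t. if s \<in> ?I then ?f else 0)"
    by (intro sum_mono le)
  also have "\<dots> = card ({..<t} \<inter> ?I) * ?f"
    by (simp add: sum.If_cases Int_def)
  also have "\<dots> \<le> card ?I * ?f"
    by (intro mult_right_mono card_mono) auto
  finally have "real (\<Sum>s<t. remaining n r p S s i) \<le> real (?f * ?f)"
    by (simp only: of_nat_le_iff card_atLeastLessThan)
  moreover have "real ?f = flow r S i"
    using release_less_completion[OF assms] by (simp add: flow_def of_nat_diff)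
  ultimately show ?thesis by (simp add: power2_eq_square)
qed


subsection \<open>SRPT\<close>

text \<open>
  Apart from its \<open>m\<close> longest remainders, SRPT has no more work left than any other schedule has
  apart from any \<open>m\<close> jobs. In the induction, an executed job inside \<open>R'\<close> is exchanged for an
  outside one, so that SRPT always works outside \<open>R'\<close>; newly released jobs are put into \<open>R'\<close> iff
  they are in \<open>R\<close>.
\<close>

lemma srpt_majorization:
  assumes srpt: "is_srpt n r p srpt" and S: "schedule n r p S" and R: "R \<subseteq> {..<n}"
  shows "\<exists>R'\<subseteq>{..<n}. card R' \<le> card R \<and>
    (\<Sum>i\<in>{..<n} - R'. remaining n r p srpt t i) \<le> (\<Sum>i\<in>{..<n} - R. remaining n r p S t i)"
  using R
proof (induction t arbitrary: R)
  case 0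
  have sch: "schedule n r p srpt" using srpt by (simp add: is_srpt_def)
  have "remaining n r p srpt 0 i = remaining n r p S 0 i" for i
    by (simp add: remaining_def active_def)
  then show ?case using 0 by auto
next
  case (Suc t R)
  have sch: "schedule n r p srpt" using srpt by (simp add: is_srpt_def)
  let ?y = "remaining n r p srpt" and ?u = "remaining n r p S"
  let ?y' = "\<lambda>i. ?y t i - (if srpt t = Some i then 1 else 0)"
  let ?u' = "\<lambda>i. ?u t i - (if S t = Some i then 1 else 0)"
  let ?N = "{i. i < n \<and> r i = Suc t}"
  have fin: "finite X" if "X \<subseteq> {..<n}" for X using that finite_subset by blast
  have y_new: "?y t i = 0" "?u t i = 0" if "i \<in> ?N" for i
    using that by (auto simp: remaining_def active_def)
  \<comment> \<open>The induction hypothesis may spend only \<open>card Q\<close> jobs, which leaves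
    room for adding \<open>R \<inter> ?N\<close> to \<open>R'\<close> at the end.\<close>
  define Q where "Q = R - ?N"
  have Q: "Q \<subseteq> {..<n}" using Suc.prems by (auto simp: Q_def)
  have "\<exists>R'\<subseteq>{..<n}. card R' \<le> card Q \<and>
    (\<Sum>i\<in>{..<n} - R'. ?y' i) \<le> (\<Sum>i\<in>{..<n} - Q. ?u' i)"
  proof -
    obtain R' where R': "R' \<subseteq> {..<n}" "card R' \<le> card Q"
      and le: "(\<Sum>i\<in>{..<n} - R'. ?y t i) \<le> (\<Sum>i\<in>{..<n} - Q. ?u t i)"
      using Suc.IH[OF Q] by blast
    have u: "(\<Sum>i\<in>{..<n} - Q. ?u t i) \<le> (\<Sum>i\<in>{..<n} - Q. ?u' i) + 1"
    proof -
      have "(\<Sum>i\<in>{..<n} - Q. ?u t i) \<le>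
          (\<Sum>i\<in>{..<n} - Q. ?u' i + (if S t = Some i then 1 else 0))"
        by (intro sum_mono) auto
      also have "\<dots> \<le> (\<Sum>i\<in>{..<n} - Q. ?u' i) + 1"
        by (cases "S t") (auto simp: sum.distrib)
      finally show ?thesis .
    qed
    show ?thesis
    \<comment> \<open>If nothing remains outside \<open>R'\<close>, SRPT need not make progress
      there, but then the left-hand side is zero anyway.\<close>
    proof (cases "(\<Sum>i\<in>{..<n} - R'. ?y t i) = 0")
      case True
      then have "(\<Sum>i\<in>{..<n} - R'. ?y' i) = 0" by simp
      with R' show ?thesis by (intro exI[of _ R'] conjI) (simp_all only: le0)
    next
      case False
      then obtain a where a: "a < n" "a \<notin> R'" "?y t a > 0" by auto
      then have "active n r p srpt t a" by (auto simp: remaining_def split: if_splits)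
      then obtain i where i: "srpt t = Some i" "active n r p srpt t i" "?y t i \<le> ?y t a"
        using srpt by (auto simp: is_srpt_def)
      have i_n: "i < n" and i_pos: "?y t i > 0" using i by (auto simp: active_def remaining_def)
      obtain R'' where R'': "R'' \<subseteq> {..<n}" "card R'' \<le> card R'" "i \<notin> R''"
        and le2: "(\<Sum>j\<in>{..<n} - R''. ?y t j) \<le> (\<Sum>j\<in>{..<n} - R'. ?y t j)"
      proof (cases "i \<in> R'")
        case True
        let ?P = "insert a (R' - {i})"
        have "{..<n} - ?P = insert i ({..<n} - R' - {a})" using True a i_n by auto
        then have "(\<Sum>j\<in>{..<n} - ?P. ?y t j) = ?y t i + (\<Sum>j\<in>{..<n} - R' - {a}. ?y t j)"
          using True by simp
        also have "\<dots> \<le> ?y t a + (\<Sum>j\<in>{..<n} - R' - {a}. ?y t j)" using i by simp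
        also have "\<dots> = (\<Sum>j\<in>{..<n} - R'. ?y t j)"
          using a by (subst sum.remove[of "{..<n} - R'" a]) auto
        finally have "(\<Sum>j\<in>{..<n} - ?P. ?y t j) \<le> (\<Sum>j\<in>{..<n} - R'. ?y t j)" .
        moreover have "card ?P = card R'"
          using card_Suc_Diff1[OF fin[OF R'(1)] True] a fin[OF R'(1)] by simp
        ultimately show ?thesis
          using True a R'(1) by (intro that[of ?P]) auto
      next
        case False
        then show ?thesis using R'(1) by (intro that[of R']) auto
      qed
      \<comment> \<open>SRPT loses a full unit outside \<open>R''\<close>, since
        \<open>?y t i\<close> is positive, while \<open>S\<close> loses at most one outside
        \<open>Q\<close>.\<close>
      have "(\<Sum>j\<in>{..<n} - R''. ?y t j) = (\<Sum>j\<in>{..<n} - R''. ?y' j + (if j = i then 1 else 0))"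
        using i i_pos by (intro sum.cong) auto
      also have "\<dots> = (\<Sum>j\<in>{..<n} - R''. ?y' j) + 1"
        using i_n R'' by (simp add: sum.distrib)
      finally have "(\<Sum>j\<in>{..<n} - R''. ?y' j) \<le> (\<Sum>i\<in>{..<n} - Q. ?u' i)"
        using le2 le u by linarith
      then show ?thesis using R'' R' by (meson order.trans)
    qed
  qed
  then obtain R' where R': "R' \<subseteq> {..<n}" "card R' \<le> card Q"
    and le: "(\<Sum>i\<in>{..<n} - R'. ?y' i) \<le> (\<Sum>i\<in>{..<n} - Q. ?u' i)" by blast
  let ?R = "R' \<union> (R \<inter> ?N)"
  let ?g = "\<lambda>i. if r i = Suc t then p i else 0"
  have "(\<Sum>i\<in>{..<n} - ?R. ?y (Suc t) i) =
      (\<Sum>i\<in>{..<n} - ?R. ?y' i) + (\<Sum>i\<in>{..<n} - ?R. ?g i)"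
    by (simp add: remaining_Suc[OF sch] sum.distrib)
  also have "\<dots> \<le> (\<Sum>i\<in>{..<n} - R'. ?y' i) + (\<Sum>i\<in>{..<n} - R. ?g i)"
  proof (rule add_mono)
    show "(\<Sum>i\<in>{..<n} - ?R. ?g i) \<le> (\<Sum>i\<in>{..<n} - R. ?g i)"
    proof -
      have "(\<Sum>i\<in>{..<n} - ?R. ?g i) = (\<Sum>i\<in>{..<n} - ?R - R. ?g i)"
        by (rule sum.mono_neutral_right) auto
      also have "\<dots> \<le> (\<Sum>i\<in>{..<n} - R. ?g i)" by (rule sum_mono2) auto
      finally show ?thesis .
    qed
  qed (intro sum_mono2; auto)
  also have "\<dots> \<le> (\<Sum>i\<in>{..<n} - Q. ?u' i) + (\<Sum>i\<in>{..<n} - R. ?g i)"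
    using le by simp
  also have "(\<Sum>i\<in>{..<n} - Q. ?u' i) = (\<Sum>i\<in>{..<n} - R. ?u' i)"
    by (rule sum.mono_neutral_right) (auto simp: Q_def y_new)
  also have "\<dots> + (\<Sum>i\<in>{..<n} - R. ?g i) = (\<Sum>i\<in>{..<n} - R. ?u (Suc t) i)"
    by (simp add: remaining_Suc[OF S] sum.distrib)
  finally have "(\<Sum>i\<in>{..<n} - ?R. ?y (Suc t) i) \<le> (\<Sum>i\<in>{..<n} - R. ?u (Suc t) i)" .
  moreover have "card ?R \<le> card R"
  proof -
    have "card ?R \<le> card R' + card (R \<inter> ?N)" by (rule card_Un_le)
    also have "\<dots> \<le> card Q + card (R \<inter> ?N)" using R' by simp
    also have "\<dots> = card R"
      unfolding Q_def using card_Diff_subset_Int[of R ?N] fin[OF Suc.prems]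
        card_mono[of R "R \<inter> ?N"] by simp
    finally show ?thesis .
  qed
  moreover have "?R \<subseteq> {..<n}" using R' by auto
  ultimately show ?case by blast
qed

section \<open>Lower bounds on the cost of an arbitrary schedule\<close>

lemma remaining_antimono:
  assumes "i < n" "r i \<le> s" "s \<le> t"
  shows "remaining n r p S t i \<le> remaining n r p S s i"
  using executed_mono[OF assms(3), of S i] assms by (simp add: remaining_eq diff_le_mono2)

text \<open>A unit left at \<open>t\<close> was also left in each of the \<open>t - r i\<close>
  slots since release. Majorization with an empty set shows that SRPT has the least total work left
  at every time, so summing over time gives a comparison with \<open>S\<close>.\<close>

lemma sum_age_remaining_srpt_le_cost:
  assumes srpt: "is_srpt n r p srpt" and S: "schedule n r p S" and p: "\<And>i. i < n \<Longrightarrow> 1 \<le> p i"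
  shows "(\<Sum>i<n. real (t - r i) * real (remaining n r p srpt t i)) \<le> cost n r S"
proof -
  let ?y = "remaining n r p srpt"
  have "(\<Sum>i<n. real (t - r i) * real (?y t i)) \<le> (\<Sum>i<n. \<Sum>s<t. real (?y s i))"
  proof (rule sum_mono)
    fix i assume "i \<in> {..<n}"
    then have i: "i < n" by simp
    have "real (t - r i) * real (?y t i) = (\<Sum>s\<in>{r i..<t}. real (?y t i))" by simp
    also have "\<dots> \<le> (\<Sum>s\<in>{r i..<t}. real (?y s i))"
      using remaining_antimono[OF i] by (intro sum_mono) simp
    also have "\<dots> \<le> (\<Sum>s<t. real (?y s i))" by (rule sum_mono2) auto
    finally show "real (t - r i) * real (?y t i) \<le> (\<Sum>s<t. real (?y s i))" .
  qed
  also have "\<dots> = (\<Sum>s<t. real (\<Sum>i<n. ?y s i))"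
    by (subst sum.swap) simp
  also have "\<dots> \<le> (\<Sum>s<t. real (\<Sum>i<n. remaining n r p S s i))"
  proof (rule sum_mono)
    fix s
    obtain R' where "R' \<subseteq> {..<n}" "card R' \<le> card ({} :: nat set)"
      and le: "(\<Sum>i\<in>{..<n} - R'. ?y s i) \<le> (\<Sum>i\<in>{..<n} - {}. remaining n r p S s i)"
      using srpt_majorization[OF srpt S, of "{}" s] by blast
    then have "R' = {}" using finite_subset[of R' "{..<n}"] by simp
    with le show "real (\<Sum>i<n. ?y s i) \<le> real (\<Sum>i<n. remaining n r p S s i)"
      by (simp only: Diff_empty of_nat_le_iff)
  qed
  also have "\<dots> = (\<Sum>i<n. \<Sum>s<t. real (remaining n r p S s i))"
    by (subst sum.swap) simp
  also have "\<dots> \<le> cost n r S"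
    unfolding cost_def using p by (intro sum_mono sum_remaining_le_square_flow[OF S]) auto
  finally show ?thesis .
qed

text \<open>\<open>R\<close> consists of the released jobs that finish after \<open>t + V\<close>.
  Each has flow time above \<open>V\<close>, and what is left of the other released jobs fits into
  the next \<open>V\<close> slots.\<close>

lemma unfinished_le_cost:
  assumes S: "schedule n r p S" and V: "0 \<le> V"
  obtains R where "R \<subseteq> {..<n}" "real (\<Sum>i\<in>{..<n} - R. remaining n r p S t i) \<le> V"
    "real (card R) * V\<^sup>2 \<le> cost n r S"
proof
  let ?R = "{i. i < n \<and> r i \<le> t \<and> real t + V < real (completion S i)}"
  let ?A = "{i. i < n \<and> r i \<le> t \<and> real (completion S i) \<le> real t + V}"
  show R: "?R \<subseteq> {..<n}" by auto
  have "(\<Sum>i\<in>{..<n} - ?R. remaining n r p S t i) = (\<Sum>i\<in>?A. remaining n r p S t i)"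
    by (rule sum.mono_neutral_right) (auto simp: remaining_eq)
  also have "\<dots> \<le> nat \<lfloor>V\<rfloor>"
  proof (rule sum_remaining_le[OF S])
    fix i assume "i \<in> ?A"
    then have "real (completion S i) \<le> real t + V" by simp
    then show "completion S i \<le> t + nat \<lfloor>V\<rfloor>" by linarith
  qed auto
  finally show "real (\<Sum>i\<in>{..<n} - ?R. remaining n r p S t i) \<le> V"
    using V by linarith
  have "real (card ?R) * V\<^sup>2 = (\<Sum>i\<in>?R. V\<^sup>2)" by simp
  also have "\<dots> \<le> (\<Sum>i\<in>?R. (flow r S i)\<^sup>2)"
    using V by (intro sum_mono power_mono) (auto simp: flow_def)
  also have "\<dots> \<le> cost n r S"
    unfolding cost_def using R by (intro sum_mono2) auto
  finally show "real (card ?R) * V\<^sup>2 \<le> cost n r S" .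
qed

text \<open>
  An upper bound, read off the SRPT schedule, for the remaining time of a job that has reached
  the age ratio \<open>\<theta>\<close>. For unreleased jobs the first argument of \<open>min\<close> is zero.
\<close>

definition starving_load ::
  "nat \<Rightarrow> (nat \<Rightarrow> nat) \<Rightarrow> (nat \<Rightarrow> nat) \<Rightarrow> real \<Rightarrow> sched \<Rightarrow> nat \<Rightarrow> nat \<Rightarrow> real" where
  "starving_load n r p \<theta> S t i = min (real (remaining n r p S t i)) (real (t - r i) / \<theta>)"

lemma starving_load_nonneg: "\<theta> > 0 \<Longrightarrow> 0 \<le> starving_load n r p \<theta> S t i"
  by (simp add: starving_load_def)

text \<open>
  Write \<open>Z = \<Sum> z\<^sub>i\<close>. Every unit of \<open>z\<^sub>i\<close> has been waiting for \<open>\<theta> z\<^sub>i\<close> slots, which costs any schedule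
  at least \<open>\<theta> \<Sum> z\<^sub>i\<^sup>2\<close>. If it takes \<open>k\<close> jobs to carry half of \<open>Z\<close>, then by majorization \<open>k\<close> jobs
  of \<open>S\<close> have flow time at least \<open>Z / 2\<close>, hence cost at least \<open>k Z\<^sup>2 / 4\<close>. As \<open>k \<Sum> z\<^sub>i\<^sup>2 \<ge> Z\<^sup>2 / 4\<close> by Cauchy--Schwarz, the
  geometric mean of the two bounds is at least \<open>\<surd>\<theta> Z\<^sup>2 / 4\<close>.
\<close>

lemma srpt_starving_load_le_cost:
  assumes srpt: "is_srpt n r p srpt" and S: "schedule n r p S"
    and p: "\<And>i. i < n \<Longrightarrow> 1 \<le> p i" and \<theta>: "\<theta> > 0"
  shows "sqrt \<theta> * (\<Sum>i<n. starving_load n r p \<theta> srpt t i)\<^sup>2 \<le> 4 * cost n r S"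
proof -
  let ?z = "starving_load n r p \<theta> srpt t"
  let ?Z = "\<Sum>i<n. ?z i"
  let ?F = "cost n r S"
  have z0: "0 \<le> ?z i" for i using \<theta> by (rule starving_load_nonneg)
  have Z0: "0 \<le> ?Z / 2" by (simp add: sum_nonneg z0)
  have "\<theta> * (\<Sum>i<n. (?z i)\<^sup>2) \<le> (\<Sum>i<n. real (t - r i) * real (remaining n r p srpt t i))"
    unfolding sum_distrib_left
  proof (rule sum_mono)
    fix i
    have "?z i \<le> real (t - r i) / \<theta>" and y: "?z i \<le> real (remaining n r p srpt t i)"
      by (simp_all add: starving_load_def)
    then have "\<theta> * ?z i \<le> real (t - r i)" using \<theta> by (simp add: pos_le_divide_eq mult.commute)
    then have "(\<theta> * ?z i) * ?z i \<le> real (t - r i) * real (remaining n r p srpt t i)"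
      using y z0 by (intro mult_mono) auto
    then show "\<theta> * (?z i)\<^sup>2 \<le> real (t - r i) * real (remaining n r p srpt t i)"
      by (simp add: power2_eq_square mult.assoc)
  qed
  also have "\<dots> \<le> ?F" by (rule sum_age_remaining_srpt_le_cost[OF srpt S p])
  finally have F1: "\<theta> * (\<Sum>i<n. (?z i)\<^sup>2) \<le> ?F" .
  \<comment> \<open>\<open>R\<close> is found in \<open>S\<close>. Its SRPT counterpart
    \<open>R'\<close> leaves at most half of \<open>?Z\<close> outside, hence carries at least the
    other half.\<close>
  obtain R where R: "R \<subseteq> {..<n}" "real (\<Sum>i\<in>{..<n} - R. remaining n r p S t i) \<le> ?Z / 2"
    and F2: "real (card R) * (?Z / 2)\<^sup>2 \<le> ?F"
    using unfinished_le_cost[OF S Z0] by blast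
  obtain R' where R': "R' \<subseteq> {..<n}" "card R' \<le> card R"
    and le: "(\<Sum>i\<in>{..<n} - R'. remaining n r p srpt t i) \<le> (\<Sum>i\<in>{..<n} - R. remaining n r p S t i)"
    using srpt_majorization[OF srpt S R(1)] by blast
  have "(\<Sum>i\<in>{..<n} - R'. ?z i) \<le> real (\<Sum>i\<in>{..<n} - R'. remaining n r p srpt t i)"
    unfolding of_nat_sum by (intro sum_mono) (simp add: starving_load_def)
  also have "\<dots> \<le> ?Z / 2" using le R(2) by linarith
  finally have "?Z / 2 \<le> (\<Sum>i\<in>R'. ?z i)"
    using sum.subset_diff[OF R'(1), of ?z] by simp
  then have "(?Z / 2)\<^sup>2 \<le> (\<Sum>i\<in>R'. ?z i)\<^sup>2" using Z0 by (rule power_mono)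
  also have "\<dots> \<le> (\<Sum>i\<in>R'. (?z i)\<^sup>2) * real (card R')"
    by (rule sum_squared_le_sum_of_squares)
  also have "\<dots> \<le> (\<Sum>i<n. (?z i)\<^sup>2) * real (card R)"
    using R' by (intro mult_mono sum_mono2) (auto simp: sum_nonneg)
  finally have N: "(?Z / 2)\<^sup>2 \<le> (\<Sum>i<n. (?z i)\<^sup>2) * real (card R)" .
  have F0: "0 \<le> ?F" by (simp add: cost_def sum_nonneg)
  have "(sqrt \<theta> * (?Z / 2)\<^sup>2)\<^sup>2 = \<theta> * (?Z / 2)\<^sup>2 * (?Z / 2)\<^sup>2"
    using \<theta> by (simp add: power_mult_distrib power2_eq_square[of "(?Z / 2)\<^sup>2"])
  also have "\<dots> \<le> \<theta> * ((\<Sum>i<n. (?z i)\<^sup>2) * real (card R)) * (?Z / 2)\<^sup>2"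
    using N \<theta> by (intro mult_right_mono mult_left_mono) auto
  also have "\<dots> = (\<theta> * (\<Sum>i<n. (?z i)\<^sup>2)) * (real (card R) * (?Z / 2)\<^sup>2)" by simp
  also have "\<dots> \<le> ?F * ?F"
    using F0 by (intro mult_mono F1 F2) auto
  finally have "(sqrt \<theta> * (?Z / 2)\<^sup>2)\<^sup>2 \<le> ?F\<^sup>2" by (simp only: power2_eq_square[of ?F])
  then have "sqrt \<theta> * (?Z / 2)\<^sup>2 \<le> ?F" using F0 by (rule power2_le_imp_le)
  then show ?thesis by (simp add: power_divide)
qed


subsection \<open>Comparing \<open>BAL\<close> with SRPT\<close>

lemma triggered_bound:
  assumes "triggered n r p \<theta> S t i"
  shows "\<theta> * real (p i - executed S t i) \<le> real (t - r i)"
  using assms by (auto simp: triggered_def age_ratio_def remaining_def active_def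
      pos_le_divide_eq of_nat_diff)

lemma onset_triggered:
  assumes "triggered n r p \<theta> S t i"
  shows "triggered n r p \<theta> S (onset n r p \<theta> S i) i" "onset n r p \<theta> S i \<le> t"
  unfolding onset_def using assms by (rule LeastI Least_le)+

lemma bal_starving_slot:
  assumes "bal n r p \<theta> srpt t = Some i" "starving n r p \<theta> (bal n r p \<theta> srpt) t j"
  shows "starving n r p \<theta> (bal n r p \<theta> srpt) t i"
    and "i \<noteq> j \<Longrightarrow> precedes n r p \<theta> (bal n r p \<theta> srpt) i j"
proof -
  let ?B = "bal n r p \<theta> srpt"
  have ex: "\<exists>k. starving n r p \<theta> ?B t k" using assms(2) by blast
  then have "i = (THE i. starving n r p \<theta> ?B t i \<and>
      (\<forall>j. starving n r p \<theta> ?B t j \<and> j \<noteq> i \<longrightarrow> precedes n r p \<theta> ?B i j))"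
    using assms(1) by (simp add: bal_step[of _ _ _ _ _ t] bal_choice_def)
  with theI'[OF starving_choice[OF ex]]
  have *: "starving n r p \<theta> ?B t i \<and>
      (\<forall>j. starving n r p \<theta> ?B t j \<and> j \<noteq> i \<longrightarrow> precedes n r p \<theta> ?B i j)" by simp
  then show "starving n r p \<theta> ?B t i" by blast
  show "i \<noteq> j \<Longrightarrow> precedes n r p \<theta> ?B i j" using * assms(2) by blast
qed

text \<open>The selected task is one that SRPT has executed by the end of the slot, and by
  \<open>task_choice\<close> it is the next task of its job.\<close>

lemma bal_normal_slot:
  assumes "bal n r p \<theta> srpt t = Some i" "\<nexists>j. starving n r p \<theta> (bal n r p \<theta> srpt) t j"
  shows "executed (bal n r p \<theta> srpt) (Suc t) i \<le> executed srpt (Suc t) i"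
proof -
  let ?D = "tasks_before srpt (Suc t) - tasks_before (bal n r p \<theta> srpt) t"
  have D: "?D \<noteq> {}" and i: "i = fst (ARG_MIN (task_completion srpt) x. x \<in> ?D)"
    using assms by (auto simp: bal_step[of _ _ _ _ _ t] bal_choice_def split: if_splits)
  have "(i, Suc (executed (bal n r p \<theta> srpt) t i)) \<in> tasks_before srpt (Suc t)"
    using task_choice[OF D] i by metis
  then show ?thesis using assms(1) by (simp add: mem_tasks_before executed_Suc)
qed

text \<open>Until it is triggered, a job runs in normal slots only, and these never put it ahead of
  SRPT.\<close>

lemma executed_bal_le_srpt:
  assumes "\<And>s. s < t \<Longrightarrow> \<not> triggered n r p \<theta> (bal n r p \<theta> srpt) s i"
  shows "executed (bal n r p \<theta> srpt) t i \<le> executed srpt t i"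
  using assms
proof (induction t)
  case (Suc t)
  let ?B = "bal n r p \<theta> srpt"
  have IH: "executed ?B t i \<le> executed srpt t i" using Suc by simp
  show ?case
  proof (cases "?B t = Some i")
    case True
    have "\<not> starving n r p \<theta> ?B t i" using Suc.prems by (auto simp: starving_def)
    then show ?thesis using bal_starving_slot(1)[OF True] bal_normal_slot[OF True] by blast
  next
    case False
    then show ?thesis using IH by (simp add: executed_Suc)
  qed
qed simp

text \<open>There is no lead at onset, so a later lead is at most the work BAL had left on the job
  at onset, which the trigger condition bounds through the age.\<close>

lemma bal_lead_bound:
  assumes srpt: "is_srpt n r p srpt" and \<theta>: "\<theta> > 0"
  shows "\<theta> * real (executed (bal n r p \<theta> srpt) t i - executed srpt t i) \<le> real (t - r i)"
proof (cases "\<exists>s<t. triggered n r p \<theta> (bal n r p \<theta> srpt) s i")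
  case True
  let ?B = "bal n r p \<theta> srpt"
  let ?s = "onset n r p \<theta> ?B i"
  obtain s where s: "s < t" "triggered n r p \<theta> ?B s i" using True by blast
  have trig: "triggered n r p \<theta> ?B ?s i" and "?s < t" using onset_triggered[OF s(2)] s(1) by auto
  have "\<not> triggered n r p \<theta> ?B s' i" if "s' < ?s" for s'
    using that onset_triggered(2)[of n r p \<theta> ?B s' i] by force
  then have "executed ?B ?s i \<le> executed srpt ?s i" by (rule executed_bal_le_srpt)
  also have "\<dots> \<le> executed srpt t i" using \<open>?s < t\<close> by (simp add: executed_mono)
  finally have "executed ?B t i - executed srpt t i \<le> p i - executed ?B ?s i"
    using bal_executed_le[OF srpt, of \<theta> t i] by linarith
  then have "\<theta> * real (executed ?B t i - executed srpt t i) \<le> \<theta> * real (p i - executed ?B ?s i)"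
    using \<theta> by simp
  also have "\<dots> \<le> real (?s - r i)" by (rule triggered_bound[OF trig])
  also have "\<dots> \<le> real (t - r i)" using \<open>?s < t\<close> by simp
  finally show ?thesis .
next
  case False
  then have "executed (bal n r p \<theta> srpt) t i \<le> executed srpt t i"
    by (intro executed_bal_le_srpt) blast
  then show ?thesis by simp
qed

text \<open>Converse of \<open>work_bal_le\<close>. If BAL idles in slot \<open>t\<close>, it has
  already executed every task that SRPT executes through slot \<open>t\<close>. Otherwise it gains a
  unit and SRPT gains at most one.\<close>

lemma work_srpt_le_bal:
  assumes srpt: "is_srpt n r p srpt"
  shows "work n srpt t \<le> work n (bal n r p \<theta> srpt) t"
proof (induction t)
  case (Suc t)
  let ?B = "bal n r p \<theta> srpt"
  have B: "work n ?B (Suc t) = work n ?B t + (if ?B t = None then 0 else 1)"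
    by (rule work_Suc) (use bal_active[OF srpt] in \<open>auto simp: active_def\<close>)
  have W: "work n srpt (Suc t) = work n srpt t + (if srpt t = None then 0 else 1)"
    by (rule work_Suc) (use srpt in \<open>auto simp: is_srpt_def schedule_def\<close>)
  show ?case
  proof (cases "?B t")
    case None
    then have D: "tasks_before srpt (Suc t) \<subseteq> tasks_before ?B t"
      by (auto simp: bal_step[of _ _ _ _ _ t] bal_choice_def split: if_splits)
    have "executed srpt (Suc t) j \<le> executed ?B t j" for j
    proof (cases "executed srpt (Suc t) j")
      case (Suc m)
      then have "(j, Suc m) \<in> tasks_before srpt (Suc t)" by (simp add: mem_tasks_before)
      then have "(j, Suc m) \<in> tasks_before ?B t" using D by blast
      then show ?thesis using Suc by (simp add: mem_tasks_before)
    qed simp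
    then have "work n srpt (Suc t) \<le> work n ?B t" by (auto simp: work_def intro: sum_mono)
    then show ?thesis using B by simp
  qed (use B W Suc in auto)
qed (simp add: work_def)

text \<open>From \<open>t\<close> until \<open>i\<close> completes, every slot serves an unfinished
  job with onset at most \<open>t\<close>, since \<open>precedes\<close> compares onsets first. Such
  a job was already starving at \<open>t\<close>.\<close>

lemma starv_le_sum_remaining:
  assumes srpt: "is_srpt n r p srpt" and i: "i < n" "1 \<le> p i"
    and trig: "triggered n r p \<theta> (bal n r p \<theta> srpt) s i"
  defines "t \<equiv> onset n r p \<theta> (bal n r p \<theta> srpt) i"
  shows "starv n r p \<theta> srpt i \<le>
    real (\<Sum>j | starving n r p \<theta> (bal n r p \<theta> srpt) t j. remaining n r p (bal n r p \<theta> srpt) t j)"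
proof -
  let ?B = "bal n r p \<theta> srpt"
  let ?A = "{j. starving n r p \<theta> ?B t j}"
  let ?fut = "\<lambda>j. {s. t \<le> s \<and> ?B s = Some j}"
  have B: "schedule n r p ?B" by (rule schedule_bal[OF srpt])
  have A: "?A \<subseteq> {..<n}" by (auto simp: starving_def active_def)
  then have finA: "finite ?A" by (rule finite_subset) simp
  have t: "triggered n r p \<theta> ?B t i" unfolding t_def by (rule onset_triggered(1)[OF trig])
  have "{t..<completion ?B i} \<subseteq> (\<Union>j\<in>?A. ?fut j)"
  proof
    fix s assume s: "s \<in> {t..<completion ?B i}"
    have "r i \<le> t" using t by (auto simp: triggered_def active_def)
    then have act: "active n r p ?B s i" using active_iff[where t=s, OF B i] s by auto
    then obtain j where j: "?B s = Some j" using bal_busy[OF srpt] by blast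
    have st: "starving n r p \<theta> ?B s i" using act t s by (auto simp: starving_def)
    have jst: "starving n r p \<theta> ?B s j" by (rule bal_starving_slot(1)[OF j st])
    have "onset n r p \<theta> ?B j \<le> t"
      using bal_starving_slot(2)[OF j st] by (cases "j = i") (auto simp: precedes_def t_def)
    moreover have jt: "triggered n r p \<theta> ?B (onset n r p \<theta> ?B j) j"
      using jst onset_triggered(1) by (auto simp: starving_def)
    moreover have "executed ?B t j < p j"
      using jst executed_mono[of t s ?B j] s by (auto simp: starving_def active_def)
    ultimately have "starving n r p \<theta> ?B t j"
      by (auto simp: starving_def active_def triggered_def)
    then show "s \<in> (\<Union>j\<in>?A. ?fut j)" using j s by auto
  qed
  moreover have fin: "finite (?fut j)" if "j \<in> ?A" for j
    using card_future_slots(1)[OF B] that A by auto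
  ultimately have "card {t..<completion ?B i} \<le> card (\<Union>j\<in>?A. ?fut j)"
    using finA by (intro card_mono) auto
  also have "\<dots> \<le> (\<Sum>j\<in>?A. card (?fut j))" by (rule card_UN_le[OF finA])
  also have "\<dots> = (\<Sum>j\<in>?A. remaining n r p ?B t j)"
  proof (rule sum.cong[OF refl])
    fix j assume "j \<in> ?A"
    then have "j < n" "r j \<le> t" by (auto simp: starving_def active_def)
    then show "card (?fut j) = remaining n r p ?B t j"
      using card_future_slots(2)[OF B, of j t] by (simp add: remaining_eq)
  qed
  finally have "completion ?B i - t \<le> (\<Sum>j\<in>?A. remaining n r p ?B t j)" by simp
  moreover have "starv n r p \<theta> srpt i = real (completion ?B i) - real t"
    using trig by (auto simp: starv_def starve_time_def t_def)
  ultimately show ?thesis by linarith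
qed

text \<open>
  \<open>BAL\<close> and SRPT have done the same amount of work, so the tasks \<open>BAL\<close> is behind on are as many as
  those it is ahead with. It gets ahead only with starving jobs, and then by at most their load.
\<close>

lemma starving_remaining_le:
  assumes srpt: "is_srpt n r p srpt" and \<theta>: "\<theta> > 0"
    and A: "\<And>i. i \<in> A \<Longrightarrow> starving n r p \<theta> (bal n r p \<theta> srpt) t i"
  shows "real (\<Sum>i\<in>A. remaining n r p (bal n r p \<theta> srpt) t i) \<le>
    2 * (\<Sum>i<n. starving_load n r p \<theta> srpt t i)"
proof -
  let ?B = "bal n r p \<theta> srpt"
  let ?z = "starving_load n r p \<theta> srpt t"
  let ?e = "\<lambda>i. executed ?B t i" and ?f = "\<lambda>i. executed srpt t i"
  have sch: "schedule n r p srpt" using srpt by (simp add: is_srpt_def)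
  have An: "A \<subseteq> {..<n}" using A by (auto simp: starving_def active_def)
  have z0: "0 \<le> ?z i" for i using \<theta> by (rule starving_load_nonneg)
  \<comment> \<open>The tasks in a lead are still open under SRPT, which gives the other argument of
    \<open>min\<close>.\<close>
  have lead: "real (?e i - ?f i) \<le> ?z i" if i: "i < n" for i
  proof (cases "r i \<le> t")
    case True
    have "real (?e i - ?f i) \<le> real (t - r i) / \<theta>"
      using bal_lead_bound[OF srpt \<theta>, of t i] \<theta> by (simp add: pos_le_divide_eq mult.commute)
    moreover have "?e i - ?f i \<le> remaining n r p srpt t i"
      using bal_executed_le[OF srpt, of \<theta> t i] True i by (simp add: remaining_eq diff_le_mono)
    ultimately show ?thesis by (simp add: starving_load_def)
  next
    case False
    then show ?thesis using bal_executed_early[OF srpt, of t i] z0 by simp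
  qed
  \<comment> \<open>The trigger bound persists, because remaining work only shrinks and age only
    grows. If \<open>min\<close> selects the SRPT remainder instead, the lag of BAL makes up the
    difference.\<close>
  have rem: "real (remaining n r p ?B t i) \<le> ?z i + real (?f i - ?e i)" if "i \<in> A" for i
  proof -
    have st: "starving n r p \<theta> ?B t i" using A that .
    then have act: "i < n" "r i \<le> t" by (auto simp: starving_def active_def)
    obtain s where s: "s \<le> t" "triggered n r p \<theta> ?B s i" using st by (auto simp: starving_def)
    have "\<theta> * real (p i - ?e i) \<le> \<theta> * real (p i - executed ?B s i)"
      using \<theta> executed_mono[OF s(1), of ?B i] by simp
    also have "\<dots> \<le> real (s - r i)" by (rule triggered_bound[OF s(2)])
    also have "\<dots> \<le> real (t - r i)" using s(1) by simp
    finally have "real (p i - ?e i) \<le> real (t - r i) / \<theta>"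
      using \<theta> by (simp add: pos_le_divide_eq mult.commute)
    moreover have "real (p i - ?e i) \<le> real (p i - ?f i) + real (?f i - ?e i)"
      using schedule_executed_le[OF sch act(1), of t] by linarith
    ultimately show ?thesis
      using act by (simp add: remaining_eq starving_load_def min_def)
  qed
  \<comment> \<open>With truncated subtraction, both sides sum the larger of \<open>?e i\<close> and
    \<open>?f i\<close>.\<close>
  have "(\<Sum>i<n. real (?f i - ?e i)) + (\<Sum>i<n. real (?e i)) =
      (\<Sum>i<n. real (?e i - ?f i)) + (\<Sum>i<n. real (?f i))"
    unfolding sum.distrib[symmetric] by (intro sum.cong) auto
  moreover have "(\<Sum>i<n. real (?f i)) \<le> (\<Sum>i<n. real (?e i))"
    using work_srpt_le_bal[OF srpt, of t \<theta>] unfolding work_def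
    by (simp only: of_nat_sum[symmetric] of_nat_le_iff)
  ultimately have lag: "(\<Sum>i<n. real (?f i - ?e i)) \<le> (\<Sum>i<n. real (?e i - ?f i))" by linarith
  have "real (\<Sum>i\<in>A. remaining n r p ?B t i) \<le> (\<Sum>i\<in>A. ?z i + real (?f i - ?e i))"
    unfolding of_nat_sum by (intro sum_mono rem)
  also have "\<dots> \<le> (\<Sum>i<n. ?z i + real (?f i - ?e i))"
    using An z0 by (intro sum_mono2) (auto simp: add_nonneg_nonneg)
  also have "\<dots> \<le> (\<Sum>i<n. ?z i) + (\<Sum>i<n. real (?e i - ?f i))"
    using lag by (simp add: sum.distrib)
  also have "\<dots> \<le> (\<Sum>i<n. ?z i) + (\<Sum>i<n. ?z i)"
    using lead by (intro add_left_mono sum_mono) auto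
  finally show ?thesis by simp
qed

text \<open>The constant is 16 = 4 * 4: the factor 2 from \<open>starving_remaining_le\<close> is
  squared, and \<open>srpt_starving_load_le_cost\<close> contributes another 4.\<close>

lemma starv_square_le:
  assumes srpt: "is_srpt n r p srpt" and S: "schedule n r p S"
    and p: "\<And>i. i < n \<Longrightarrow> 1 \<le> p i" and \<theta>: "\<theta> > 0" and i: "i < n"
  shows "(starv n r p \<theta> srpt i)\<^sup>2 \<le> 16 * (cost n r S / sqrt \<theta>)"
proof (cases "\<exists>t. triggered n r p \<theta> (bal n r p \<theta> srpt) t i")
  case True
  let ?B = "bal n r p \<theta> srpt"
  let ?t = "onset n r p \<theta> ?B i"
  let ?Z = "\<Sum>i<n. starving_load n r p \<theta> srpt ?t i"
  obtain s where s: "triggered n r p \<theta> ?B s i" using True by blast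
  have "starv n r p \<theta> srpt i \<le> 2 * ?Z"
    using starv_le_sum_remaining[OF srpt i p[OF i] s]
      starving_remaining_le[OF srpt \<theta>, of "{j. starving n r p \<theta> ?B ?t j}" ?t] by simp
  moreover have "0 \<le> starv n r p \<theta> srpt i"
  proof -
    have "?t < completion ?B i"
      using onset_triggered(1)[OF s] active_iff[OF schedule_bal[OF srpt] i p[OF i]]
      by (auto simp: triggered_def)
    then show ?thesis using True by (auto simp: starv_def starve_time_def)
  qed
  ultimately have "(starv n r p \<theta> srpt i)\<^sup>2 \<le> (2 * ?Z)\<^sup>2" by (rule power_mono)
  also have "\<dots> = 4 * ?Z\<^sup>2" by simp
  also have "?Z\<^sup>2 \<le> 4 * cost n r S / sqrt \<theta>"
    using srpt_starving_load_le_cost[OF srpt S p \<theta>, of ?t] \<theta>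
    by (simp add: pos_le_divide_eq mult.commute)
  finally show ?thesis by simp
next
  case False
  then show ?thesis using \<theta> by (simp add: starv_def starve_time_def cost_def sum_nonneg)
qed

theorem theorem3p2:
  shows "\<exists>C>0. \<forall>(n::nat) (r::nat \<Rightarrow> nat) (p::nat \<Rightarrow> nat) (\<theta>::real) (srpt::sched) (opt::sched).
    (\<forall>i<n. p i \<ge> 1) \<longrightarrow> \<theta> > 0 \<longrightarrow> is_srpt n r p srpt \<longrightarrow> optimal n r p opt \<longrightarrow>
    (\<Sum>i<n. (starv n r p \<theta> srpt i)\<^sup>2) \<le> C * (real n / sqrt \<theta>) * cost n r opt"
proof (intro exI[of _ 16] conjI allI impI)
  fix n :: nat and r p :: "nat \<Rightarrow> nat" and \<theta> :: real and srpt opt :: sched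
  assume p: "\<forall>i<n. p i \<ge> 1" and \<theta>: "\<theta> > 0" and srpt: "is_srpt n r p srpt"
    and opt: "optimal n r p opt"
  have "(\<Sum>i<n. (starv n r p \<theta> srpt i)\<^sup>2) \<le> (\<Sum>i<n. 16 * (cost n r opt / sqrt \<theta>))"
    using p opt by (intro sum_mono starv_square_le[OF srpt _ _ \<theta>]) (auto simp: optimal_def)
  then show "(\<Sum>i<n. (starv n r p \<theta> srpt i)\<^sup>2) \<le> 16 * (real n / sqrt \<theta>) * cost n r opt"
    by (simp add: mult_ac)
qed simp

end
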